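(* Let $G$ be a finite group. Every Hartley set $\mathcal{H}$ of $G$ can be defined by a full integrated $H$-function, i.e. there is a full integrated $H$-function $h$ of $G$ with $\mathcal{H}=HS(h)$.
   Context: All groups are finite; $\mathbb{P}$ is the set of all primes. $\mathfrak{N}_p$ is the class of $p$-groups and $\mathfrak{E}_{p'}$ the class of all (finite) $p'$-groups; $\mathfrak{E}_{p'}\mathfrak{N}_p$ is the class of groups having a normal $p'$-subgroup with $p$-group quotient ($p$-nilpotent groups). A nonempty set $\mathcal{F}$ of subgroups of $G$ is a Fitting set of $G$ if: (i) $T\unlhd S\in\mathcal{F}$ implies $T\in\mathcal{F}$; (ii) $S,T\in\mathcal{F}$ with $S\unlhd ST$ and $T\unlhd ST$ implies $ST\in\mathcal{F}$; (iii) $S\in\mathcal{F}$ and $x\in G$ implies $S^x\in\mathcal{F}$. For $H\leq G$, $H_{\mathcal{F}}$ is the product of all normal subgroups of $H$ that belong to $\mathcal{F}$. A Fitting class is a class of groups closed under normal subgroups and products of normal subgroups belonging to the class. For a Fitting set $\mathcal{F}$ of $G$ and a nonempty Fitting class $\mathfrak{X}$, $\mathcal{F}\circ\mathfrak{X}=\{H\leq G: H/H_{\mathcal{F}}\in\mathfrak{X}\}$, which is a Fitting set of $G$. An $H$-function of $G$ is a function $h$ from $\mathbb{P}$ to the set of Fitting sets of $G$. Put $HS(h)=\bigcap_{p\in\mathbb{P}}h(p)\circ(\mathfrak{E}_{p'}\mathfrak{N}_{p})$. A Fitting set $\mathcal{H}$ of $G$ is a Hartley set of $G$ if $\mathcal{H}=HS(h)$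 for some $H$-function $h$ of $G$ (then $\mathcal{H}$ is defined by $h$). Such an $h$ is integrated if $h(p)\subseteq\mathcal{H}$ for all primes $p$; full if $h(p)\subseteq h(q)\circ\mathfrak{E}_{q'}$ for all different primes $p,q$; full integrated if it is both. *)

theory Defs
  imports "HOL-Algebra.Coset" "HOL-Algebra.Generated_Groups"
    "HOL-Computational_Algebra.Primes"
begin

text \<open>Subgroups of \<open>G\<close> are represented by their carriers; a subgroup \<open>H\<close> regarded as a group
  is \<open>G\<lparr>carrier := H\<rparr>\<close>.\<close>

abbreviation normal_in :: "('a, 'b) monoid_scheme \<Rightarrow> 'a set \<Rightarrow> 'a set \<Rightarrow> bool" where
  "normal_in G N H \<equiv> N \<lhd> G\<lparr>carrier := H\<rparr>"

text \<open>Both classes consist of finite groups, since \<^const>\<open>order\<close> is 0 for infinite carriers.\<close>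

definition p_group :: "nat \<Rightarrow> ('a, 'b) monoid_scheme \<Rightarrow> bool" where
  "p_group p K \<longleftrightarrow> group K \<and> (\<exists>n. order K = p ^ n)"

definition p'_group :: "nat \<Rightarrow> ('a, 'b) monoid_scheme \<Rightarrow> bool" where
  "p'_group p K \<longleftrightarrow> group K \<and> \<not> p dvd order K"

definition p_nilpotent :: "nat \<Rightarrow> ('a, 'b) monoid_scheme \<Rightarrow> bool" where
  "p_nilpotent p K \<longleftrightarrow>
    group K \<and> (\<exists>N. N \<lhd> K \<and> p'_group p (K\<lparr>carrier := N\<rparr>) \<and> p_group p (K Mod N))"

definition Fitting_set :: "('a, 'b) monoid_scheme \<Rightarrow> 'a set set \<Rightarrow> bool" where
  "Fitting_set G F \<longleftrightarrow>
    F \<noteq> {} \<and> (\<forall>S\<in>F. subgroup S G) \<and>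
    (\<forall>S T. S \<in> F \<longrightarrow> normal_in G T S \<longrightarrow> T \<in> F) \<and>
    (\<forall>S T. S \<in> F \<longrightarrow> T \<in> F \<longrightarrow>
      normal_in G S (S <#>\<^bsub>G\<^esub> T) \<longrightarrow> normal_in G T (S <#>\<^bsub>G\<^esub> T) \<longrightarrow> S <#>\<^bsub>G\<^esub> T \<in> F) \<and>
    (\<forall>S x. S \<in> F \<longrightarrow> x \<in> carrier G \<longrightarrow> (inv\<^bsub>G\<^esub> x <#\<^bsub>G\<^esub> S) #>\<^bsub>G\<^esub> x \<in> F)"

text \<open>\<open>H\<^sub>F\<close>: the product of a family of normal subgroups of \<open>H\<close> is the subgroup they generate.\<close>

definition radical :: "('a, 'b) monoid_scheme \<Rightarrow> 'a set set \<Rightarrow> 'a set \<Rightarrow> 'a set" where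
  "radical G F H = generate G (\<Union>{N \<in> F. normal_in G N H})"

text \<open>\<open>F \<circ> X\<close>. The class \<open>X\<close> is given by its members on the carrier type \<^typ>\<open>'a set\<close> of
  the quotients \<open>H / H\<^sub>F\<close>.\<close>

definition Fitting_prod ::
  "('a, 'b) monoid_scheme \<Rightarrow> 'a set set \<Rightarrow> ('a set monoid \<Rightarrow> bool) \<Rightarrow> 'a set set" where
  "Fitting_prod G F X = {H. subgroup H G \<and> X (G\<lparr>carrier := H\<rparr> Mod radical G F H)}"

text \<open>Functions on the primes are represented by functions on \<^typ>\<open>nat\<close> whose values at
  non-primes are irrelevant.\<close>

definition H_function :: "('a, 'b) monoid_scheme \<Rightarrow> (nat \<Rightarrow> 'a set set) \<Rightarrow> bool" where
  "H_function G h \<longleftrightarrow> (\<forall>p. prime p \<longrightarrow> Fitting_set G (h p))"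

definition HS :: "('a, 'b) monoid_scheme \<Rightarrow> (nat \<Rightarrow> 'a set set) \<Rightarrow> 'a set set" where
  "HS G h = (\<Inter>p\<in>{p. prime p}. Fitting_prod G (h p) (p_nilpotent p))"

definition Hartley_set :: "('a, 'b) monoid_scheme \<Rightarrow> 'a set set \<Rightarrow> bool" where
  "Hartley_set G \<H> \<longleftrightarrow> Fitting_set G \<H> \<and> (\<exists>h. H_function G h \<and> \<H> = HS G h)"

definition integrated :: "('a, 'b) monoid_scheme \<Rightarrow> (nat \<Rightarrow> 'a set set) \<Rightarrow> bool" where
  "integrated G h \<longleftrightarrow> (\<forall>p. prime p \<longrightarrow> h p \<subseteq> HS G h)"

definition full :: "('a, 'b) monoid_scheme \<Rightarrow> (nat \<Rightarrow> 'a set set) \<Rightarrow> bool" where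
  "full G h \<longleftrightarrow>
    (\<forall>p q. prime p \<longrightarrow> prime q \<longrightarrow> p \<noteq> q \<longrightarrow> h p \<subseteq> Fitting_prod G (h q) (p'_group q))"

end

theory Submission
  imports Defs "HOL-Algebra.Sylow" "HOL-Algebra.Multiplicative_Group" "HOL-Algebra.SndIsomorphismGrp"
begin

text \<open>Let \<open>\<H>\<close> be defined by \<open>h\<close>, and write \<open>D\<close> for the intersection of the products of \<open>h q\<close> with the
  class of \<open>q'\<close>-groups, over all primes \<open>q\<close>. The constant function with value \<open>D\<close> is a full integrated
  H-function that defines \<open>\<H>\<close>. Indeed \<open>D\<close> is a Fitting set; a constant H-function is full; and \<open>D\<close> lies
  in \<open>\<H>\<close> because \<open>q'\<close>-groups are \<open>q\<close>-nilpotent. What remains is that \<open>D\<close> defines the same Hartley set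
  as \<open>h\<close>.

  If \<open>K\<close> is in the Hartley set of \<open>D\<close>, then for each \<open>p\<close> the radical \<open>K\<^sub>D\<close> is a \<open>p'\<close>-group modulo
  the radical of \<open>K\<close> for \<open>h p\<close>, and an extension of a \<open>p'\<close>-group by a \<open>p\<close>-nilpotent group is
  \<open>p\<close>-nilpotent (\<open>HS_constant_core_subset\<close>). If \<open>K\<close> is in \<open>\<H>\<close>, then for each \<open>p\<close> there is a normal
  subgroup \<open>W\<close> of \<open>K\<close> that belongs to \<open>D\<close> and has a \<open>p\<close>-nilpotent quotient: intersect the radical for
  \<open>h p\<close> with the normal subgroups of \<open>K\<close> that lie over the normal \<open>q\<close>-complements modulo the radicals
  for \<open>h q\<close>, for all primes \<open>q \<noteq> p\<close> (\<open>HS_subset_HS_constant_core\<close>).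

  Quotients enter only through elements. Let \<open>A\<close> be the set of elements of \<open>K\<close> with a power in \<open>N\<close>
  whose exponent is prime to \<open>p\<close>. Then \<open>K / N\<close> is a \<open>p'\<close>-group iff \<open>A = K\<close>
  (\<open>p'_quotient_iff\<close>), and it is \<open>p\<close>-nilpotent iff \<open>A\<close> is closed under multiplication
  (\<open>p_nilpotent_quotient_iff\<close>).\<close>

section \<open>Elements of order prime to p modulo a normal subgroup\<close>

text \<open>For \<open>N\<close> normal in \<open>K\<close> this is the preimage in \<open>K\<close> of the set of \<open>p'\<close>-elements of \<open>K / N\<close>.
  Phrasing it with a power in \<open>N\<close> instead of the order of a coset makes it monotone in \<open>N\<close> and
  lets it be compared for different \<open>K\<close> and \<open>N\<close> without passing between quotient groups.\<close>

definition pprime_mod :: "('a, 'b) monoid_scheme \<Rightarrow> nat \<Rightarrow> 'a set \<Rightarrow> 'a set \<Rightarrow> 'a set" where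
  "pprime_mod G p K N = {x \<in> K. \<exists>m::nat. \<not> p dvd m \<and> x [^]\<^bsub>G\<^esub> m \<in> N}"

lemma prime_power_of_unique_prime_divisor:
  fixes n p :: nat
  assumes "n > 0" and "prime p" and "\<And>q. prime q \<Longrightarrow> q dvd n \<Longrightarrow> q = p"
  shows "\<exists>k. n = p ^ k"
proof -
  obtain m where m: "n = p ^ multiplicity p n * m" "\<not> p dvd m"
    using assms multiplicity_decompose'[of n p] by (metis not_prime_unit not_gr_zero)
  have "m = 1"
  proof (rule ccontr)
    assume "m \<noteq> 1"
    then obtain q where "prime q" "q dvd m" using prime_factor_nat by blast
    with m assms(3) show False by (metis dvd_mult)
  qed
  with m show ?thesis by auto
qed

context group
begin

lemma inv_mult_cancel_left:
  assumes "x \<in> carrier G" "y \<in> carrier G"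
  shows "inv x \<otimes> (x \<otimes> y) = y" "x \<otimes> (inv x \<otimes> y) = y"
  using m_assoc[of "inv x" x y] m_assoc[of x "inv x" y] assms by simp_all

lemma pow_dvd_mem:
  assumes "subgroup N G" "x [^] (a::nat) \<in> N" "a dvd b" "x \<in> carrier G"
  shows "x [^] b \<in> N"
proof -
  obtain c where "b = a * c" using assms(3) by blast
  then have "x [^] b = (x [^] a) [^] c" using assms(4) by (simp add: nat_pow_pow)
  moreover have "y [^] c \<in> N" if "y \<in> N" for y
    using that assms(1) by (induction c) (auto intro: subgroup.one_closed subgroup.m_closed)
  ultimately show ?thesis using assms(2) by simp
qed

text \<open>By Bezout, \<open>x\<close> is a product of powers of \<open>x\<^sup>a\<close> and \<open>x\<^sup>b\<close> and their inverses. For \<open>N\<close>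
  normal this is the argument that a coset whose order divides two coprime numbers is trivial.\<close>

lemma coprime_pow_mem:
  assumes N: "subgroup N G" and x: "x \<in> carrier G"
    and ab: "x [^] (a::nat) \<in> N" "x [^] (b::nat) \<in> N" "coprime a b"
  shows "x \<in> N"
proof (cases "a = 0")
  case True
  then show ?thesis using ab x by simp
next
  case False
  then obtain u v where uv: "a * u = b * v + 1"
    using bezout_nat[of a b] ab(3) by (auto simp: coprime_iff_gcd_eq_1)
  have "a dvd b * v + 1" by (metis uv dvd_triv_left)
  then have "x [^] (b * v) \<in> N" "x [^] (b * v) \<otimes> x \<in> N"
    using pow_dvd_mem[OF N ab(1) _ x, of "b * v + 1"] pow_dvd_mem[OF N ab(2) _ x, of "b * v"]
    by simp_all
  then have "inv (x [^] (b * v)) \<otimes> (x [^] (b * v) \<otimes> x) \<in> N"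
    using N by (simp add: subgroup.m_closed subgroup.m_inv_closed)
  then show ?thesis using x by (simp add: inv_mult_cancel_left)
qed

lemma conj_pow:
  assumes "x \<in> carrier G" "a \<in> carrier G"
  shows "(x \<otimes> a \<otimes> inv x) [^] (m::nat) = x \<otimes> a [^] m \<otimes> inv x"
proof (induction m)
  case (Suc m)
  then show ?case using assms by (simp add: m_assoc inv_mult_cancel_left)
qed (use assms in simp)

text \<open>Cauchy's theorem: Sylow's theorem, applied to the first power of \<open>p\<close>, gives a subgroup of
  order \<open>p\<close>.\<close>

lemma exists_element_of_prime_order:
  assumes "finite (carrier G)" "prime p" "p dvd order G"
  shows "\<exists>x\<in>carrier G. x \<noteq> \<one> \<and> x [^] p = \<one>"
proof -
  obtain m where "order G = p ^ 1 * m" using assms(3) by auto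
  then obtain P where P: "subgroup P G" "card P = p"
    using sylow_thm[OF assms(2) is_group, of 1 m] assms(1) by auto
  have "P \<noteq> {\<one>}" using P(2) assms(2) by auto
  then obtain x where x: "x \<in> P" "x \<noteq> \<one>" using P(1) subgroup.one_closed by blast
  interpret P: group "G\<lparr>carrier := P\<rparr>" using P(1) by (rule subgroup_imp_group)
  have "x [^]\<^bsub>G\<lparr>carrier := P\<rparr>\<^esub> order (G\<lparr>carrier := P\<rparr>) = \<one>\<^bsub>G\<lparr>carrier := P\<rparr>\<^esub>"
    using x by (intro P.pow_order_eq_1) simp
  then have "x [^] p = \<one>" using P(2) by (simp add: order_def nat_pow_consistent[symmetric])
  then show ?thesis using x subgroup.subset[OF P(1)] by blast
qed

lemma order_prime_decomposition:
  assumes "finite (carrier G)" "prime p"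
  obtains k r where "order G = p ^ k * r" "\<not> p dvd r"
proof -
  have "order G \<noteq> 0" using assms(1) order_gt_0_iff_finite by simp
  then show ?thesis
    using multiplicity_decompose'[of "order G" p] assms(2) that by (metis not_prime_unit)
qed

lemma p_group_if_p_power_exponents:
  assumes "finite (carrier G)" "prime p" "\<And>x. x \<in> carrier G \<Longrightarrow> \<exists>n::nat. x [^] (p ^ n) = \<one>"
  shows "p_group p G"
proof -
  have "q = p" if q: "prime q" "q dvd order G" for q
  proof (rule ccontr)
    assume "q \<noteq> p"
    obtain x where x: "x \<in> carrier G" "x \<noteq> \<one>" "x [^] q = \<one>"
      using exists_element_of_prime_order[OF assms(1) q] by blast
    obtain n where "x [^] (p ^ n) = \<one>" using assms(3) x(1) by blast
    moreover have "coprime q (p ^ n)"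
      using q(1) assms(2) \<open>q \<noteq> p\<close> by (simp add: primes_coprime)
    ultimately have "x \<in> {\<one>}"
      using x coprime_pow_mem[OF triv_subgroup x(1), of q "p ^ n"] by simp
    with x(2) show False by simp
  qed
  moreover have "order G > 0" using assms(1) order_gt_0_iff_finite by blast
  ultimately show ?thesis
    unfolding p_group_def using prime_power_of_unique_prime_divisor assms(2) is_group by blast
qed

text \<open>The only direction that is not Lagrange's theorem is Cauchy's: if \<open>p\<close> divided the order,
  there would be an element of order \<open>p\<close>.\<close>

lemma p'_group_iff_trivial_pprime_mod:
  assumes "finite (carrier G)" "prime p"
  shows "p'_group p G \<longleftrightarrow> carrier G \<subseteq> pprime_mod G p (carrier G) {\<one>}"
proof
  assume "p'_group p G"
  then show "carrier G \<subseteq> pprime_mod G p (carrier G) {\<one>}"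
    using pow_order_eq_1 by (auto simp: pprime_mod_def p'_group_def intro!: exI[of _ "order G"])
next
  assume *: "carrier G \<subseteq> pprime_mod G p (carrier G) {\<one>}"
  have "\<not> p dvd order G"
  proof
    assume "p dvd order G"
    then obtain x where x: "x \<in> carrier G" "x \<noteq> \<one>" "x [^] p = \<one>"
      using exists_element_of_prime_order[OF assms] by blast
    then obtain m::nat where "\<not> p dvd m" "x [^] m = \<one>"
      using * by (auto simp: pprime_mod_def)
    then have "x \<in> {\<one>}"
      using x assms(2) by (intro coprime_pow_mem[OF triv_subgroup x(1), of p m])
        (auto simp: prime_imp_coprime)
    with x(2) show False by simp
  qed
  then show "p'_group p G" by (simp add: p'_group_def is_group)
qed

lemma normal_pow:
  assumes "N \<lhd> G" "x \<in> carrier G"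
  shows "(N #> x) [^]\<^bsub>G Mod N\<^esub> (m::nat) = N #> (x [^] m)"
proof -
  interpret N: normal N G by fact
  interpret group_hom G "G Mod N" "\<lambda>a. N #> a"
    using N.r_coset_hom_Mod N.factorgroup_is_group is_group
    by (simp add: group_hom_def group_hom_axioms_def)
  show ?thesis using hom_nat_pow[OF assms(2), of m] by simp
qed

lemma rcos_pow_eq_one_iff:
  assumes "N \<lhd> G" "x \<in> carrier G"
  shows "(N #> x) [^]\<^bsub>G Mod N\<^esub> (m::nat) = \<one>\<^bsub>G Mod N\<^esub> \<longleftrightarrow> x [^] m \<in> N"
  using normal_pow[OF assms] coset_join1 coset_join2 normal_imp_subgroup[OF assms(1)] assms(2)
  by (metis nat_pow_closed one_FactGroup)

section \<open>Normality inside a subgroup\<close>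

text \<open>Inverses and products in \<open>G\<lparr>carrier := K\<rparr>\<close> are those of \<open>G\<close>; this form lets every later argument
  take place in \<open>G\<close> itself.\<close>

lemma normal_in_iff:
  assumes K: "subgroup K G"
  shows "normal_in G N K \<longleftrightarrow> subgroup N G \<and> N \<subseteq> K \<and> (\<forall>k\<in>K. \<forall>n\<in>N. k \<otimes> n \<otimes> inv k \<in> N)"
proof -
  interpret KG: group "G\<lparr>carrier := K\<rparr>" using K by (rule subgroup_imp_group)
  have "subgroup N (G\<lparr>carrier := K\<rparr>) \<longleftrightarrow> subgroup N G \<and> N \<subseteq> K"
    using incl_subgroup[OF K] subgroup_incl[OF _ K] subgroup.subset by fastforce
  then show ?thesis unfolding KG.normal_inv_iff using K by auto
qed

lemma pprime_mod_normal_in: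
  assumes K: "subgroup K G" and N: "normal_in G N K" and p: "prime p"
    and closed: "\<And>x y. x \<in> pprime_mod G p K N \<Longrightarrow> y \<in> pprime_mod G p K N
      \<Longrightarrow> x \<otimes> y \<in> pprime_mod G p K N"
  shows "normal_in G (pprime_mod G p K N) K"
proof -
  let ?A = "pprime_mod G p K N"
  have sN: "subgroup N G" "\<And>k n. k \<in> K \<Longrightarrow> n \<in> N \<Longrightarrow> k \<otimes> n \<otimes> inv k \<in> N"
    using N by (auto simp: normal_in_iff[OF K])
  have Kc: "K \<subseteq> carrier G" using K by (rule subgroup.subset)
  have "subgroup ?A G"
  proof
    show "?A \<subseteq> carrier G" using Kc by (auto simp: pprime_mod_def)
    show "\<one> \<in> ?A"
      using p K sN(1) by (auto simp: pprime_mod_def subgroup.one_closed intro!: exI[of _ 1])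
    fix x assume "x \<in> ?A"
    then obtain m::nat where m: "x \<in> K" "\<not> p dvd m" "x [^] m \<in> N" by (auto simp: pprime_mod_def)
    have "inv x \<in> K" "(inv x) [^] m \<in> N"
      using m K sN(1) Kc by (auto simp: nat_pow_inv subgroup.m_inv_closed)
    then show "inv x \<in> ?A" using m(2) by (auto simp: pprime_mod_def)
  qed (rule closed)
  moreover have "x \<otimes> a \<otimes> inv x \<in> ?A" if x: "x \<in> K" and "a \<in> ?A" for x a
  proof -
    from that obtain m::nat where m: "a \<in> K" "\<not> p dvd m" "a [^] m \<in> N"
      by (auto simp: pprime_mod_def)
    have "x \<otimes> a \<otimes> inv x \<in> K" using x m(1) K by (simp add: subgroup.m_closed subgroup.m_inv_closed)
    moreover have "(x \<otimes> a \<otimes> inv x) [^] m \<in> N"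
      using sN(2)[OF x m(3)] x m(1) Kc by (subst conj_pow) auto
    ultimately show ?thesis using m(2) by (auto simp: pprime_mod_def)
  qed
  moreover have "?A \<subseteq> K" by (auto simp: pprime_mod_def)
  ultimately show ?thesis by (auto simp: normal_in_iff[OF K])
qed

section \<open>Nilpotency at p in terms of elements\<close>

text \<open>A finite group is \<open>p\<close>-nilpotent iff its \<open>p'\<close>-elements are closed under multiplication. The
  normal \<open>p\<close>-complement, if there is one, consists of exactly the \<open>p'\<close>-elements, since these die in
  the quotient \<open>p\<close>-group. Conversely, if the \<open>p'\<close>-elements form a subgroup, then it is a normal
  \<open>p'\<close>-group, and if \<open>p\<^sup>k\<close> is the \<open>p\<close>-part of the group order, all \<open>p\<^sup>k\<close>-th powers lie in it.\<close>

lemma p_nilpotent_iff_trivial_pprime_mod: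
  assumes fin: "finite (carrier G)" and p: "prime p"
  shows "p_nilpotent p G \<longleftrightarrow>
    (\<forall>x\<in>pprime_mod G p (carrier G) {\<one>}. \<forall>y\<in>pprime_mod G p (carrier G) {\<one>}.
      x \<otimes> y \<in> pprime_mod G p (carrier G) {\<one>})"
    (is "_ \<longleftrightarrow> (\<forall>x\<in>?A. \<forall>y\<in>?A. _)")
proof
  assume "p_nilpotent p G"
  then obtain N where N: "N \<lhd> G" "p'_group p (G\<lparr>carrier := N\<rparr>)" "p_group p (G Mod N)"
    by (auto simp: p_nilpotent_def)
  interpret N: normal N G by fact
  interpret NG: group "G\<lparr>carrier := N\<rparr>" using N(2) by (simp add: p'_group_def)
  interpret Q: group "G Mod N" using N(3) by (simp add: p_group_def)
  obtain n where n: "order (G Mod N) = p ^ n" using N(3) by (auto simp: p_group_def)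
  have "x \<in> N" if "x \<in> ?A" for x
  proof -
    from that obtain m::nat where x: "x \<in> carrier G" and m: "\<not> p dvd m" "x [^] m = \<one>"
      by (auto simp: pprime_mod_def)
    have "N #> x \<in> carrier (G Mod N)" using x by (auto simp: FactGroup_def RCOSETS_def)
    then have "x [^] (p ^ n) \<in> N"
      using Q.pow_order_eq_1 n rcos_pow_eq_one_iff[OF N(1) x] by metis
    then show "x \<in> N"
      using m p by (intro coprime_pow_mem[OF N.subgroup_axioms x, of "p ^ n" m])
        (auto simp: prime_imp_coprime)
  qed
  moreover have "x \<in> ?A" if "x \<in> N" for x
  proof -
    have "x [^]\<^bsub>G\<lparr>carrier := N\<rparr>\<^esub> order (G\<lparr>carrier := N\<rparr>) = \<one>\<^bsub>G\<lparr>carrier := N\<rparr>\<^esub>"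
      using that by (intro NG.pow_order_eq_1) simp
    then show ?thesis using N(2) that N.subset
      by (auto simp: pprime_mod_def p'_group_def nat_pow_consistent[symmetric])
  qed
  ultimately have "?A = N" by blast
  then show "\<forall>x\<in>?A. \<forall>y\<in>?A. x \<otimes> y \<in> ?A" by simp
next
  assume closed: "\<forall>x\<in>?A. \<forall>y\<in>?A. x \<otimes> y \<in> ?A"
  have "?A \<lhd> G\<lparr>carrier := carrier G\<rparr>"
    using closed p by (intro pprime_mod_normal_in subgroup_self)
      (auto simp: one_is_normal)
  then have normal: "?A \<lhd> G" by simp
  have sub: "subgroup ?A G" using normal by (rule normal_imp_subgroup)
  have "p'_group p (G\<lparr>carrier := ?A\<rparr>)"
  proof -
    interpret AG: group "G\<lparr>carrier := ?A\<rparr>" using sub by (rule subgroup_imp_group)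
    have "finite ?A" using fin by (rule rev_finite_subset) (auto simp: pprime_mod_def)
    then show ?thesis using p
      by (subst AG.p'_group_iff_trivial_pprime_mod)
        (auto simp: pprime_mod_def simp flip: nat_pow_consistent)
  qed
  moreover have "p_group p (G Mod ?A)"
  proof (rule group.p_group_if_p_power_exponents)
    show "group (G Mod ?A)" using normal by (rule normal.factorgroup_is_group)
    show "finite (carrier (G Mod ?A))" using fin by (simp add: FactGroup_def RCOSETS_def)
    fix X assume "X \<in> carrier (G Mod ?A)"
    then obtain x where x: "x \<in> carrier G" "X = ?A #> x" by (auto simp: FactGroup_def RCOSETS_def)
    obtain k m where m: "order G = p ^ k * m" "\<not> p dvd m"
      using order_prime_decomposition[OF fin p] .
    have "(x [^] (p ^ k)) [^] m = \<one>"
      using x(1) m(1) pow_order_eq_1 by (metis nat_pow_pow)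
    then have "x [^] (p ^ k) \<in> ?A"
      using x(1) m(2) by (auto simp: pprime_mod_def)
    then show "\<exists>n::nat. X [^]\<^bsub>G Mod ?A\<^esub> (p ^ n) = \<one>\<^bsub>G Mod ?A\<^esub>"
      using rcos_pow_eq_one_iff[OF normal x(1)] x(2) by blast
  qed (fact p)
  ultimately show "p_nilpotent p G" unfolding p_nilpotent_def using normal is_group by blast
qed

lemma rcos_mem_pprime_mod_iff:
  assumes "N \<lhd> G" "x \<in> carrier G"
  shows "N #> x \<in> pprime_mod (G Mod N) p (carrier (G Mod N)) {\<one>\<^bsub>G Mod N\<^esub>}
    \<longleftrightarrow> x \<in> pprime_mod G p (carrier G) N"
  using assms rcos_pow_eq_one_iff[OF assms]
  by (auto simp: pprime_mod_def FactGroup_def RCOSETS_def)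

lemma p'_quotient_iff:
  assumes "finite (carrier G)" "N \<lhd> G" "prime p"
  shows "p'_group p (G Mod N) \<longleftrightarrow> carrier G \<subseteq> pprime_mod G p (carrier G) N"
proof -
  interpret Q: group "G Mod N" using assms(2) by (rule normal.factorgroup_is_group)
  have "finite (carrier (G Mod N))" using assms(1) by (simp add: FactGroup_def RCOSETS_def)
  moreover have c: "carrier (G Mod N) = (\<lambda>x. N #> x) ` carrier G"
    by (auto simp: FactGroup_def RCOSETS_def)
  ultimately show ?thesis
    using rcos_mem_pprime_mod_iff[OF assms(2)]
    by (subst Q.p'_group_iff_trivial_pprime_mod) (auto simp: assms(3) subset_iff)
qed

lemma p_nilpotent_quotient_iff:
  assumes "finite (carrier G)" "N \<lhd> G" "prime p"
  shows "p_nilpotent p (G Mod N) \<longleftrightarrow>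
    (\<forall>x\<in>pprime_mod G p (carrier G) N. \<forall>y\<in>pprime_mod G p (carrier G) N.
      x \<otimes> y \<in> pprime_mod G p (carrier G) N)"
proof -
  interpret N: normal N G by fact
  interpret Q: group "G Mod N" using assms(2) by (rule normal.factorgroup_is_group)
  let ?B = "pprime_mod (G Mod N) p (carrier (G Mod N)) {\<one>\<^bsub>G Mod N\<^esub>}"
  let ?A = "pprime_mod G p (carrier G) N"
  have fin: "finite (carrier (G Mod N))" using assms(1) by (simp add: FactGroup_def RCOSETS_def)
  have A: "x \<in> carrier G" if "x \<in> ?A" for x using that by (simp add: pprime_mod_def)
  have c: "carrier (G Mod N) = (\<lambda>x. N #> x) ` carrier G"
    by (auto simp: FactGroup_def RCOSETS_def)
  have B: "?B = (\<lambda>x. N #> x) ` ?A"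
  proof
    show "?B \<subseteq> (\<lambda>x. N #> x) ` ?A"
    proof
      fix X assume X: "X \<in> ?B"
      then have "X \<in> carrier (G Mod N)" by (simp add: pprime_mod_def)
      then obtain x where "x \<in> carrier G" "X = N #> x" unfolding c by blast
      with X show "X \<in> (\<lambda>x. N #> x) ` ?A" using rcos_mem_pprime_mod_iff[OF assms(2)] by blast
    qed
    show "(\<lambda>x. N #> x) ` ?A \<subseteq> ?B"
      by (rule image_subsetI) (simp only: A rcos_mem_pprime_mod_iff[OF assms(2)])
  qed
  have prod: "(N #> x) \<otimes>\<^bsub>G Mod N\<^esub> (N #> y) \<in> ?B \<longleftrightarrow> x \<otimes> y \<in> ?A"
    if "x \<in> ?A" "y \<in> ?A" for x y
  proof -
    have "(N #> x) \<otimes>\<^bsub>G Mod N\<^esub> (N #> y) = N #> (x \<otimes> y)"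
      using that A by (simp add: N.rcos_sum)
    then show ?thesis using rcos_mem_pprime_mod_iff[OF assms(2)] A that by (metis m_closed)
  qed
  have "(\<forall>X\<in>?B. \<forall>Y\<in>?B. X \<otimes>\<^bsub>G Mod N\<^esub> Y \<in> ?B) \<longleftrightarrow>
    (\<forall>x\<in>?A. \<forall>y\<in>?A. (N #> x) \<otimes>\<^bsub>G Mod N\<^esub> (N #> y) \<in> ?B)"
    by (subst (1 2) B) (simp only: ball_simps)
  also have "\<dots> \<longleftrightarrow> (\<forall>x\<in>?A. \<forall>y\<in>?A. x \<otimes> y \<in> ?A)"
    using prod by (simp cong: ball_cong del: mult_FactGroup)
  finally show ?thesis
    using Q.p_nilpotent_iff_trivial_pprime_mod[OF fin assms(3)] by (simp only:)
qed

section \<open>Products, intersections and conjugates of normal subgroups\<close>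

lemma normal_in_restrict:
  assumes "subgroup K G" "subgroup L G" "normal_in G N K" "N \<subseteq> L" "L \<subseteq> K"
  shows "normal_in G N L"
  using assms by (auto simp: normal_in_iff)

lemma normal_in_Int:
  assumes K: "subgroup K G" and L: "subgroup L G" and "L \<subseteq> K" and N: "normal_in G N K"
  shows "normal_in G (N \<inter> L) L"
proof -
  have "k \<otimes> n \<otimes> inv k \<in> L" if "k \<in> L" "n \<in> L" for k n
    using that L by (simp add: subgroup.m_closed subgroup.m_inv_closed)
  then show ?thesis using assms by (auto simp: normal_in_iff subgroups_Inter_pair)
qed

lemma normal_in_Inter:
  assumes K: "subgroup K G" and "\<N> \<noteq> {}" and "\<And>N. N \<in> \<N> \<Longrightarrow> normal_in G N K"
  shows "normal_in G (\<Inter>\<N>) K"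
  using assms(2,3) by (auto simp: normal_in_iff[OF K] intro!: subgroups_Inter)

lemma normal_in_set_mult:
  assumes K: "subgroup K G" and S: "normal_in G S K" and T: "normal_in G T K"
  shows "normal_in G (S <#> T) K" "S \<subseteq> S <#> T" "T \<subseteq> S <#> T"
proof -
  interpret KG: group "G\<lparr>carrier := K\<rparr>" using K by (rule subgroup_imp_group)
  interpret ST: second_isomorphism_grp S "G\<lparr>carrier := K\<rparr>" T
    using S T normal_imp_subgroup
    by (simp add: second_isomorphism_grp_def second_isomorphism_grp_axioms_def)
  show "S \<subseteq> S <#> T" "T \<subseteq> S <#> T"
    using ST.H_contained_in_set_mult ST.S_contained_in_set_mult by simp_all
  have ss: "subgroup S G" "S \<subseteq> K" "subgroup T G" "T \<subseteq> K" "K \<subseteq> carrier G"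
    using S T K by (simp_all add: normal_in_iff subgroup.subset)
  have sub: "subgroup (S <#> T) (G\<lparr>carrier := K\<rparr>)"
    using ST.normal_set_mult_subgroup by simp
  have "k \<otimes> x \<otimes> inv k \<in> S <#> T" if k: "k \<in> K" and "x \<in> S <#> T" for k x
  proof -
    from that obtain s t where st: "s \<in> S" "t \<in> T" "x = s \<otimes> t" by (auto simp: set_mult_def)
    have cl: "k \<in> carrier G" "s \<in> carrier G" "t \<in> carrier G" using st ss k by auto
    have "k \<otimes> x \<otimes> inv k = (k \<otimes> s \<otimes> inv k) \<otimes> (k \<otimes> t \<otimes> inv k)"
      using cl by (simp add: st m_assoc inv_mult_cancel_left)
    moreover have "k \<otimes> s \<otimes> inv k \<in> S" "k \<otimes> t \<otimes> inv k \<in> T"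
      using S T k st by (auto simp: normal_in_iff[OF K])
    ultimately show ?thesis by (auto simp: set_mult_def)
  qed
  then show "normal_in G (S <#> T) K"
    using sub incl_subgroup[OF K sub] subgroup.subset[OF sub] by (auto simp: normal_in_iff[OF K])
qed

lemma group_hom_inv_conj:
  assumes "x \<in> carrier G"
  shows "group_hom G G (\<lambda>s. inv x \<otimes> s \<otimes> x)"
proof -
  have "inv x \<otimes> (a \<otimes> b) \<otimes> x = inv x \<otimes> a \<otimes> x \<otimes> (inv x \<otimes> b \<otimes> x)"
    if "a \<in> carrier G" "b \<in> carrier G" for a b
    using that assms by (simp add: m_assoc inv_mult_cancel_left)
  then show ?thesis
    using assms is_group by (simp add: group_hom_def group_hom_axioms_def hom_def)
qed

lemma conjugate_eq_image:
  "(inv x <# S) #> x = (\<lambda>s. inv x \<otimes> s \<otimes> x) ` S"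
  by (auto simp: l_coset_def r_coset_def)

lemma normal_in_image:
  assumes c: "group_hom G G c" and K: "subgroup K G" and N: "normal_in G N K"
  shows "normal_in G (c ` N) (c ` K)"
proof -
  interpret c: group_hom G G c by fact
  have "c k \<otimes> c n \<otimes> inv (c k) \<in> c ` N" if kn: "k \<in> K" "n \<in> N" for k n
  proof -
    have cl: "k \<in> carrier G" "n \<in> carrier G"
      using kn subgroup.subset[OF K] N by (auto simp: normal_in_iff[OF K])
    then have "c k \<otimes> c n \<otimes> inv (c k) = c (k \<otimes> n \<otimes> inv k)" by simp
    then show ?thesis using N kn by (auto simp: normal_in_iff[OF K])
  qed
  then show ?thesis
    using N c.subgroup_img_is_subgroup K by (auto simp: normal_in_iff)
qed

lemma inv_conj_image_normal:
  assumes K: "subgroup K G" and N: "normal_in G N K" and k: "k \<in> K"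
  shows "(\<lambda>s. inv k \<otimes> s \<otimes> k) ` N = N"
proof
  let ?c = "\<lambda>s. inv k \<otimes> s \<otimes> k"
  have conj: "\<And>k n. k \<in> K \<Longrightarrow> n \<in> N \<Longrightarrow> k \<otimes> n \<otimes> inv k \<in> N" and sN: "subgroup N G"
    using N by (auto simp: normal_in_iff[OF K])
  have kc: "k \<in> carrier G" using K k by (rule subgroup.mem_carrier)
  have "?c n \<in> N" if "n \<in> N" for n
    using conj[of "inv k" n] subgroup.m_inv_closed[OF K k] that kc by simp
  then show "?c ` N \<subseteq> N" by blast
  show "N \<subseteq> ?c ` N"
  proof
    fix n assume n: "n \<in> N"
    have "n \<in> carrier G" using sN n by (rule subgroup.mem_carrier)
    then have "n = ?c (k \<otimes> n \<otimes> inv k)" using kc by (simp add: m_assoc inv_mult_cancel_left)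
    then show "n \<in> ?c ` N" using conj[OF k n] by blast
  qed
qed

section \<open>Radicals of Fitting sets\<close>

lemma Fitting_setD:
  assumes "Fitting_set G F"
  shows "F \<noteq> {}" and "S \<in> F \<Longrightarrow> subgroup S G"
    and "S \<in> F \<Longrightarrow> normal_in G T S \<Longrightarrow> T \<in> F"
    and "S \<in> F \<Longrightarrow> x \<in> carrier G \<Longrightarrow> (\<lambda>s. inv x \<otimes> s \<otimes> x) ` S \<in> F"
  using assms unfolding Fitting_set_def conjugate_eq_image by blast+

lemma trivial_mem_Fitting_set:
  assumes "Fitting_set G F"
  shows "{\<one>} \<in> F"
proof -
  obtain S where S: "S \<in> F" "subgroup S G" using Fitting_setD[OF assms] by blast
  then have "normal_in G {\<one>} S"
    by (auto simp: normal_in_iff triv_subgroup subgroup.one_closed subgroup.mem_carrier)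
  then show ?thesis using Fitting_setD(3)[OF assms] S by blast
qed

text \<open>Take a normal subgroup \<open>M\<close> of \<open>K\<close> in \<open>F\<close> of largest order. Its product with any other such
  subgroup is again one, so it equals \<open>M\<close>; hence \<open>M\<close> contains all of them and is the subgroup that
  they generate.\<close>

lemma radical_is_greatest:
  assumes fin: "finite (carrier G)" and F: "Fitting_set G F" and K: "subgroup K G"
  shows "radical G F K \<in> F" and "normal_in G (radical G F K) K"
    and "\<And>N. N \<in> F \<Longrightarrow> normal_in G N K \<Longrightarrow> N \<subseteq> radical G F K"
proof -
  let ?\<N> = "{N \<in> F. normal_in G N K}"
  have finK: "finite N" if "N \<in> ?\<N>" for N
    using that fin K by (auto simp: normal_in_iff dest!: subgroup.subset intro: finite_subset)
  have "?\<N> \<subseteq> Pow (carrier G)"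
    using K by (auto simp: normal_in_iff dest!: subgroup.subset)
  then have "finite ?\<N>" using fin by (simp add: finite_subset)
  moreover have "{\<one>} \<in> ?\<N>"
    using trivial_mem_Fitting_set[OF F] K
    by (auto simp: normal_in_iff triv_subgroup subgroup.one_closed subgroup.mem_carrier)
  ultimately obtain M where M: "M \<in> ?\<N>" and max: "\<And>N. N \<in> ?\<N> \<Longrightarrow> card N \<le> card M"
    using Max_in[of "card ` ?\<N>"] Max_ge[of "card ` ?\<N>"] by fastforce
  have le: "N \<subseteq> M" if N: "N \<in> ?\<N>" for N
  proof -
    have "normal_in G M K" "normal_in G N K" using M N by auto
    note MN = normal_in_set_mult[OF K this]
    have sub: "subgroup (M <#> N) G" "M <#> N \<subseteq> K" using MN(1) by (auto simp: normal_in_iff[OF K])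
    then have "normal_in G M (M <#> N)" "normal_in G N (M <#> N)"
      using M N MN(2,3) by (auto intro: normal_in_restrict[OF K])
    then have "M <#> N \<in> ?\<N>" using F M N MN(1) by (auto simp: Fitting_set_def)
    then have "M = M <#> N" using max MN(2) finK by (simp add: card_seteq)
    then show ?thesis using MN(3) by simp
  qed
  have sM: "subgroup M G" using M K by (simp add: normal_in_iff)
  have "radical G F K = M"
    unfolding radical_def
    by (rule generateI[OF sM, symmetric]) (use le M in blast)+
  then show "radical G F K \<in> F" "normal_in G (radical G F K) K"
    "\<And>N. N \<in> F \<Longrightarrow> normal_in G N K \<Longrightarrow> N \<subseteq> radical G F K"
    using M le by auto
qed

text \<open>\<open>N\<^sub>F\<close> is invariant under conjugation by \<open>K\<close>, because conjugation permutes the normal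
  subgroups of \<open>N\<close> that belong to \<open>F\<close>; so it is normal in \<open>K\<close> and lies in \<open>K\<^sub>F\<close>. In the other
  direction \<open>K\<^sub>F \<inter> N\<close> is normal in \<open>K\<^sub>F\<close>, hence belongs to \<open>F\<close>, and it is normal in \<open>N\<close>.\<close>

lemma radical_normal_subgroup:
  assumes fin: "finite (carrier G)" and F: "Fitting_set G F" and K: "subgroup K G"
    and N: "normal_in G N K"
  shows "radical G F N = radical G F K \<inter> N"
proof
  have sN: "subgroup N G" "N \<subseteq> K" using N by (auto simp: normal_in_iff[OF K])
  note rN = radical_is_greatest[OF fin F sN(1)] and rK = radical_is_greatest[OF fin F K]
  have sr: "subgroup (radical G F N) G" "radical G F N \<subseteq> N"
    using rN(2) by (auto simp: normal_in_iff[OF sN(1)])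
  have "k \<otimes> n \<otimes> inv k \<in> radical G F N" if k: "k \<in> K" and n: "n \<in> radical G F N" for k n
  proof -
    let ?c = "\<lambda>s. inv (inv k) \<otimes> s \<otimes> inv k"
    have kc: "k \<in> carrier G" using K k by (rule subgroup.mem_carrier)
    have ik: "inv k \<in> K" using K k by (rule subgroup.m_inv_closed)
    have "?c ` N = N" using K N ik by (rule inv_conj_image_normal)
    then have "normal_in G (?c ` radical G F N) N"
      using normal_in_image[OF group_hom_inv_conj sN(1) rN(2), of "inv k"] kc by simp
    then have "?c ` radical G F N \<subseteq> radical G F N"
      using rN(3) Fitting_setD(4)[OF F rN(1)] kc by blast
    then show ?thesis using n kc by auto
  qed
  then have "normal_in G (radical G F N) K"
    using sr sN by (auto simp: normal_in_iff[OF K])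
  then show "radical G F N \<subseteq> radical G F K \<inter> N" using rK(3) rN(1) sr(2) by blast
next
  have sN: "subgroup N G" "N \<subseteq> K" using N by (auto simp: normal_in_iff[OF K])
  note rK = radical_is_greatest[OF fin F K]
  have sr: "subgroup (radical G F K) G" "radical G F K \<subseteq> K"
    using rK(2) by (auto simp: normal_in_iff[OF K])
  have "normal_in G (N \<inter> radical G F K) (radical G F K)"
    using normal_in_Int[OF K sr N] .
  then have "radical G F K \<inter> N \<in> F" using Fitting_setD(3)[OF F rK(1)] by (simp add: Int_commute)
  moreover have "normal_in G (radical G F K \<inter> N) N" using normal_in_Int[OF K sN rK(2)] .
  ultimately show "radical G F K \<inter> N \<subseteq> radical G F N"
    using radical_is_greatest(3)[OF fin F sN(1)] by blast
qed

section \<open>The products of a Fitting set with the two classes\<close>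

lemma Fitting_prod_p'_group:
  assumes fin: "finite (carrier G)" and F: "Fitting_set G F" and p: "prime p"
  shows "K \<in> Fitting_prod G F (p'_group p) \<longleftrightarrow>
    subgroup K G \<and> K \<subseteq> pprime_mod G p K (radical G F K)"
proof (cases "subgroup K G")
  case K: True
  interpret KG: group "G\<lparr>carrier := K\<rparr>" using K by (rule subgroup_imp_group)
  have "finite K" using K fin by (meson finite_subset subgroup.subset)
  then show ?thesis
    using KG.p'_quotient_iff[OF _ radical_is_greatest(2)[OF fin F K] p] K
    by (simp add: Fitting_prod_def pprime_mod_def flip: nat_pow_consistent)
qed (simp add: Fitting_prod_def)

lemma Fitting_prod_p_nilpotent:
  assumes fin: "finite (carrier G)" and F: "Fitting_set G F" and p: "prime p"
  shows "K \<in> Fitting_prod G F (p_nilpotent p) \<longleftrightarrow> subgroup K G \<and>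
    (\<forall>x\<in>pprime_mod G p K (radical G F K). \<forall>y\<in>pprime_mod G p K (radical G F K).
      x \<otimes> y \<in> pprime_mod G p K (radical G F K))"
proof (cases "subgroup K G")
  case K: True
  interpret KG: group "G\<lparr>carrier := K\<rparr>" using K by (rule subgroup_imp_group)
  have "finite K" using K fin by (meson finite_subset subgroup.subset)
  then show ?thesis
    using KG.p_nilpotent_quotient_iff[OF _ radical_is_greatest(2)[OF fin F K] p] K
    by (simp add: Fitting_prod_def pprime_mod_def flip: nat_pow_consistent)
qed (simp add: Fitting_prod_def)

text \<open>In \<open>K / N\<close> the elements \<open>n \<otimes> x\<close> and \<open>x\<close> have the same powers.\<close>

lemma mult_pow_mod_normal:
  assumes K: "subgroup K G" and N: "normal_in G N K" and "n \<in> N" "x \<in> K"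
  shows "\<exists>n'\<in>N. (n \<otimes> x) [^] (m::nat) = n' \<otimes> x [^] m"
proof (induction m)
  case 0
  have "\<one> \<in> N" using N K by (simp add: normal_in_iff subgroup.one_closed)
  then show ?case by (auto intro!: bexI[of _ \<one>])
next
  case (Suc m)
  then obtain n' where n': "n' \<in> N" "(n \<otimes> x) [^] m = n' \<otimes> x [^] m" by blast
  have sN: "subgroup N G" "N \<subseteq> carrier G" and xc: "x \<in> carrier G"
    using N assms(4) K by (auto simp: normal_in_iff subgroup.subset subgroup.mem_carrier)
  have xm: "x [^] m \<in> K" using pow_dvd_mem[OF K, of x 1 m] xc assms(4) by simp
  let ?n'' = "x [^] m \<otimes> n \<otimes> inv (x [^] m)"
  have "?n'' \<in> N" using N xm assms(3) by (auto simp: normal_in_iff[OF K])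
  moreover have "(n \<otimes> x) [^] Suc m = (n' \<otimes> ?n'') \<otimes> x [^] Suc m"
    using n' sN xc assms(3) by (simp add: m_assoc inv_mult_cancel_left subset_iff)
  ultimately show ?case using n'(1) sN(1) subgroup.m_closed by metis
qed

text \<open>The splitting of \<open>x\<close> into its \<open>p\<close>-part and its \<open>p'\<close>-part: if \<open>x\<^sup>m \<in> N\<close> with \<open>m\<close> prime to \<open>p\<close>,
  then the \<open>p\<close>-part of \<open>x\<close> lies in \<open>N\<close>, while the \<open>p'\<close>-part belongs to \<^const>\<open>pprime_mod\<close> for every
  subgroup \<open>W\<close>.\<close>

lemma pprime_mod_decompose:
  assumes fin: "finite (carrier G)" and p: "prime p" and K: "subgroup K G"
    and N: "subgroup N G" and W: "subgroup W G" and x: "x \<in> pprime_mod G p K N"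
  shows "\<exists>n\<in>N. \<exists>a\<in>pprime_mod G p K W. x = n \<otimes> a"
proof -
  from x obtain m :: nat where xK: "x \<in> K" and m: "\<not> p dvd m" "x [^] m \<in> N"
    by (auto simp: pprime_mod_def)
  have xc: "x \<in> carrier G" using K xK by (rule subgroup.mem_carrier)
  obtain k r where r: "order G = p ^ k * r" "\<not> p dvd r"
    using order_prime_decomposition[OF fin p] .
  define q where "q = p ^ k"
  have "coprime m q" using m(1) p unfolding q_def
    by (metis coprime_commute coprime_power_right_iff prime_imp_coprime)
  moreover have "m \<noteq> 0" using m(1) by (metis dvd_0_right)
  ultimately obtain u v where uv: "m * u = q * v + 1"
    using bezout_nat[of m q] by (auto simp: coprime_iff_gcd_eq_1)
  let ?b = "x [^] (q * v)"
  have b: "?b \<in> K" using pow_dvd_mem[OF K, of x 1 "q * v"] xK xc by simp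
  have n: "x [^] (m * u) \<in> N" using pow_dvd_mem[OF N m(2) _ xc] by simp
  have "x [^] (m * u) = x \<otimes> ?b" unfolding uv using xc by (simp add: nat_pow_comm flip: nat_pow_Suc2)
  then have "x = x [^] (m * u) \<otimes> inv ?b" using xc by (simp add: m_assoc)
  moreover have "inv ?b \<in> pprime_mod G p K W"
  proof -
    have "order G * v = q * v * r" using r(1) by (simp add: q_def)
    then have "?b [^] r = x [^] (order G * v)" using xc by (simp only: nat_pow_pow)
    also have "\<dots> = \<one>" using xc pow_order_eq_1 by (simp flip: nat_pow_pow)
    finally have "(inv ?b) [^] r = \<one>" using xc by (simp add: nat_pow_inv)
    then show ?thesis
      using b r(2) K W by (auto simp: pprime_mod_def subgroup.m_inv_closed subgroup.one_closed)
  qed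
  ultimately show ?thesis using n by blast
qed

text \<open>For \<open>W\<close> normal in \<open>K\<close> this says that a quotient \<open>K / N\<close> of a \<open>p\<close>-nilpotent group \<open>K / W\<close> is
  \<open>p\<close>-nilpotent. By the decomposition above, \<open>p'\<close>-elements modulo \<open>N\<close> come from \<open>p'\<close>-elements modulo
  \<open>W\<close>, up to factors in \<open>N\<close>, which do not matter modulo \<open>N\<close>.\<close>

lemma pprime_mod_closed_mono:
  assumes fin: "finite (carrier G)" and p: "prime p" and K: "subgroup K G"
    and N: "normal_in G N K" and W: "subgroup W G" "W \<subseteq> N"
    and closed: "\<And>x y. x \<in> pprime_mod G p K W \<Longrightarrow> y \<in> pprime_mod G p K W
      \<Longrightarrow> x \<otimes> y \<in> pprime_mod G p K W"
    and x: "x \<in> pprime_mod G p K N" and y: "y \<in> pprime_mod G p K N"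
  shows "x \<otimes> y \<in> pprime_mod G p K N"
proof -
  have sN: "subgroup N G" "N \<subseteq> K" using N by (auto simp: normal_in_iff[OF K])
  have Kc: "K \<subseteq> carrier G" using K by (rule subgroup.subset)
  obtain n a where na: "n \<in> N" "a \<in> pprime_mod G p K W" "x = n \<otimes> a"
    using pprime_mod_decompose[OF fin p K sN(1) W(1) x] by blast
  obtain n' b where nb: "n' \<in> N" "b \<in> pprime_mod G p K W" "y = n' \<otimes> b"
    using pprime_mod_decompose[OF fin p K sN(1) W(1) y] by blast
  have aK: "a \<in> K" "b \<in> K" using na nb by (auto simp: pprime_mod_def)
  have cl: "a \<in> carrier G" "b \<in> carrier G" "n \<in> carrier G" "n' \<in> carrier G"
    using aK na(1) nb(1) sN(2) Kc by auto
  \<comment> \<open>collect the factors from \<open>N\<close> on the left\<close>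
  let ?c = "n \<otimes> (a \<otimes> n' \<otimes> inv a)"
  have "a \<otimes> n' \<otimes> inv a \<in> N" using N aK nb(1) by (auto simp: normal_in_iff[OF K])
  then have c: "?c \<in> N" using sN(1) na(1) by (simp add: subgroup.m_closed)
  have xy: "x \<otimes> y = ?c \<otimes> (a \<otimes> b)"
    using cl by (simp add: na nb m_assoc inv_mult_cancel_left)
  obtain m :: nat where m: "\<not> p dvd m" "(a \<otimes> b) [^] m \<in> W"
    using closed[OF na(2) nb(2)] by (auto simp: pprime_mod_def)
  have ab: "a \<otimes> b \<in> K" using aK K by (simp add: subgroup.m_closed)
  then obtain d where "d \<in> N" "(x \<otimes> y) [^] m = d \<otimes> (a \<otimes> b) [^] m"
    using mult_pow_mod_normal[OF K N c ab, of m] xy by auto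
  then have "(x \<otimes> y) [^] m \<in> N" using m(2) W(2) sN(1) by (auto simp: subgroup.m_closed)
  moreover have "x \<otimes> y \<in> K" using xy c sN(2) ab K by (auto simp: subgroup.m_closed)
  ultimately show ?thesis using m(1) by (auto simp: pprime_mod_def)
qed

text \<open>A \<open>p'\<close>-quotient \<open>L / N\<close> can be absorbed: replacing \<open>L\<close> by \<open>N\<close> does not remove elements that
  have \<open>p'\<close>-order modulo \<open>L\<close>.\<close>

lemma subset_pprime_mod_trans:
  assumes p: "prime p" and N: "subgroup N G" and K: "subgroup K G" and "L \<subseteq> pprime_mod G p L N"
  shows "pprime_mod G p K L \<subseteq> pprime_mod G p K N"
proof
  fix x assume "x \<in> pprime_mod G p K L"
  then obtain m :: nat where m: "x \<in> K" "\<not> p dvd m" "x [^] m \<in> L" by (auto simp: pprime_mod_def)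
  then obtain m' :: nat where m': "\<not> p dvd m'" "(x [^] m) [^] m' \<in> N"
    using assms(4) by (auto simp: pprime_mod_def subset_iff)
  then have "x [^] (m * m') \<in> N" using subgroup.mem_carrier[OF K m(1)] by (simp add: nat_pow_pow)
  moreover have "\<not> p dvd m * m'" using p m(2) m'(1) by (simp add: prime_dvd_mult_iff)
  ultimately show "x \<in> pprime_mod G p K N" using m(1) by (auto simp: pprime_mod_def)
qed

text \<open>The clause on products is the one with content. Let \<open>U = ST\<close> and \<open>x = st\<close>. Modulo the normal
  subgroup \<open>S\<close>, some \<open>p'\<close>-power of \<open>x\<close> agrees with one of \<open>t\<close> that lies in \<open>T\<^sub>F \<le> U\<^sub>F\<close>. So this power
  of \<open>x\<close> is, modulo \<open>U\<^sub>F\<close>, an element of \<open>S\<close>, and a further \<open>p'\<close>-power of it lies in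
  \<open>S\<^sub>F U\<^sub>F = U\<^sub>F\<close>.\<close>

lemma Fitting_set_Fitting_prod_p'_group:
  assumes fin: "finite (carrier G)" and F: "Fitting_set G F" and p: "prime p"
  shows "Fitting_set G (Fitting_prod G F (p'_group p))"
proof -
  let ?D = "Fitting_prod G F (p'_group p)" and ?R = "radical G F"
  note iff = Fitting_prod_p'_group[OF fin F p]
  have sR: "subgroup (?R K) G" if "subgroup K G" for K
    using radical_is_greatest(2)[OF fin F that] that by (simp add: normal_in_iff)
  have one: "{\<one>} \<in> ?D"
    using p sR[OF triv_subgroup]
    by (auto simp: iff triv_subgroup pprime_mod_def subgroup.one_closed intro!: exI[of _ 1])
  have normal: "T \<in> ?D" if S: "S \<in> ?D" and T: "normal_in G T S" for S T
  proof -
    have sS: "subgroup S G" and SR: "S \<subseteq> pprime_mod G p S (?R S)" using S by (auto simp: iff)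
    have sT: "subgroup T G" "T \<subseteq> S" using T by (auto simp: normal_in_iff[OF sS])
    have "x \<in> pprime_mod G p T (?R T)" if "x \<in> T" for x
    proof -
      have "x \<in> S" using that sT by blast
      with SR obtain m :: nat where m: "\<not> p dvd m" "x [^] m \<in> ?R S"
        by (auto simp: pprime_mod_def)
      moreover have "x [^] m \<in> T"
        using pow_dvd_mem[OF sT(1), of x 1 m] that subgroup.mem_carrier[OF sT(1)] by simp
      ultimately show ?thesis
        using that radical_normal_subgroup[OF fin F sS T] by (auto simp: pprime_mod_def)
    qed
    then show ?thesis using sT by (auto simp: iff)
  qed
  have mult: "S <#> T \<in> ?D"
    if S: "S \<in> ?D" and T: "T \<in> ?D"
      and nS: "normal_in G S (S <#> T)" and nT: "normal_in G T (S <#> T)" for S T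
  proof -
    let ?U = "S <#> T"
    have sS: "subgroup S G" "S \<subseteq> pprime_mod G p S (?R S)"
      and sT: "subgroup T G" "T \<subseteq> pprime_mod G p T (?R T)" using S T by (auto simp: iff)
    have "?U \<subseteq> carrier G"
      using sS(1) sT(1) by (simp add: set_mult_closed subgroup.subset)
    moreover have "group (G\<lparr>carrier := ?U\<rparr>)" using nS by (simp add: normal_def)
    ultimately have U: "subgroup ?U G" by (simp add: group_incl_imp_subgroup)
    have RU: "normal_in G (?R ?U) ?U" "subgroup (?R ?U) G"
      using radical_is_greatest(2)[OF fin F U] sR[OF U] by auto
    have "x \<in> pprime_mod G p ?U (?R ?U)" if xU: "x \<in> ?U" for x
    proof -
      obtain s t where st: "s \<in> S" "t \<in> T" "x = s \<otimes> t" using xU by (auto simp: set_mult_def)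
      have xc: "x \<in> carrier G" using U xU by (rule subgroup.mem_carrier)
      have TU: "t \<in> ?U" using nT st(2) by (auto simp: normal_in_iff[OF U])
      obtain m :: nat where m: "\<not> p dvd m" "t [^] m \<in> ?R T"
        using sT(2) st(2) by (auto simp: pprime_mod_def)
      then have tm: "t [^] m \<in> ?R ?U" using radical_normal_subgroup[OF fin F U nT] by auto
      obtain s' where s': "s' \<in> S" "x [^] m = s' \<otimes> t [^] m"
        using mult_pow_mod_normal[OF U nS st(1) TU, of m] st(3) by auto
      obtain l :: nat where l: "\<not> p dvd l" "s' [^] l \<in> ?R S"
        using sS(2) s'(1) by (auto simp: pprime_mod_def)
      then have sl: "s' [^] l \<in> ?R ?U" using radical_normal_subgroup[OF fin F U nS] by auto
      have s'U: "s' \<in> ?U" using nS s'(1) by (auto simp: normal_in_iff[OF U])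
      have cl: "s' \<in> carrier G" "t \<in> carrier G"
        using s'U TU subgroup.mem_carrier[OF U] by auto
      \<comment> \<open>move the factor from \<open>U\<^sub>F\<close> to the left, where taking powers modulo \<open>U\<^sub>F\<close> absorbs it\<close>
      let ?u = "s' \<otimes> t [^] m \<otimes> inv s'"
      have u: "?u \<in> ?R ?U" using RU(1) s'U tm by (auto simp: normal_in_iff[OF U])
      have "x [^] m = ?u \<otimes> s'" using s'(2) cl by (simp add: m_assoc)
      then obtain u' where "u' \<in> ?R ?U" "(x [^] m) [^] l = u' \<otimes> s' [^] l"
        using mult_pow_mod_normal[OF U RU(1) u s'U, of l] by auto
      then have "x [^] (m * l) \<in> ?R ?U"
        using sl RU(2) xc by (simp add: nat_pow_pow subgroup.m_closed)
      moreover have "\<not> p dvd m * l" using p m(1) l(1) by (simp add: prime_dvd_mult_iff)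
      ultimately show ?thesis using xU by (auto simp: pprime_mod_def)
    qed
    then show ?thesis using U by (auto simp: iff)
  qed
  have conj: "(\<lambda>s. inv x \<otimes> s \<otimes> x) ` S \<in> ?D" if S: "S \<in> ?D" and x: "x \<in> carrier G" for S x
  proof -
    let ?c = "\<lambda>s. inv x \<otimes> s \<otimes> x"
    interpret c: group_hom G G ?c using x by (rule group_hom_inv_conj)
    have sS: "subgroup S G" "S \<subseteq> pprime_mod G p S (?R S)" using S by (auto simp: iff)
    note RS = radical_is_greatest[OF fin F sS(1)]
    have cS: "subgroup (?c ` S) G" using sS(1) by (rule c.subgroup_img_is_subgroup)
    have "normal_in G (?c ` ?R S) (?c ` S)"
      using normal_in_image[OF c.group_hom_axioms sS(1) RS(2)] .
    moreover have "?c ` ?R S \<in> F" using Fitting_setD(4)[OF F RS(1) x] .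
    ultimately have sub: "?c ` ?R S \<subseteq> ?R (?c ` S)"
      using radical_is_greatest(3)[OF fin F cS] by blast
    have "?c s \<in> pprime_mod G p (?c ` S) (?R (?c ` S))" if s: "s \<in> S" for s
    proof -
      obtain m :: nat where m: "\<not> p dvd m" "s [^] m \<in> ?R S"
        using sS(2) s by (auto simp: pprime_mod_def)
      have "?c s [^] m = ?c (s [^] m)"
        using c.hom_nat_pow[of s m] subgroup.mem_carrier[OF sS(1) s] by simp
      then have "?c s [^] m \<in> ?R (?c ` S)" using m(2) sub by auto
      then show ?thesis using m(1) s by (auto simp: pprime_mod_def)
    qed
    then show ?thesis using cS by (auto simp: iff)
  qed
  show "Fitting_set G ?D"
    unfolding Fitting_set_def conjugate_eq_image
  proof (intro conjI allI impI ballI)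
    show "?D \<noteq> {}" using one by blast
    show "subgroup S G" if "S \<in> ?D" for S using that by (simp add: iff)
  qed (use normal mult conj in blast)+
qed

text \<open>The intersection is not empty because the trivial subgroup lies in every Fitting set.\<close>

lemma Fitting_set_Inter:
  assumes "\<F> \<noteq> {}" and F: "\<And>F. F \<in> \<F> \<Longrightarrow> Fitting_set G F"
  shows "Fitting_set G (\<Inter>\<F>)"
proof -
  have "\<Inter>\<F> \<noteq> {}" using trivial_mem_Fitting_set[OF F] by blast
  moreover have "subgroup S G" if "S \<in> \<Inter>\<F>" for S
    using that assms(1) Fitting_setD(2)[OF F] by blast
  moreover have "T \<in> \<Inter>\<F>" if "S \<in> \<Inter>\<F>" "normal_in G T S" for S T
    using that Fitting_setD(3)[OF F] by blast
  moreover have "S <#> T \<in> \<Inter>\<F>" if "S \<in> \<Inter>\<F>" "T \<in> \<Inter>\<F>"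
    "normal_in G S (S <#> T)" "normal_in G T (S <#> T)" for S T
    using that F unfolding Fitting_set_def by blast
  moreover have "(\<lambda>s. inv x \<otimes> s \<otimes> x) ` S \<in> \<Inter>\<F>" if "S \<in> \<Inter>\<F>" "x \<in> carrier G" for S x
    using that Fitting_setD(4)[OF F] by blast
  ultimately show ?thesis unfolding Fitting_set_def conjugate_eq_image by blast
qed

end

section \<open>A constant H-function for a Hartley set\<close>

text \<open>The single value of the new H-function. Taking all primes at once is what makes it independent of
  a prime and still small enough to lie in the Hartley set.\<close>

definition constant_core ::
  "('a, 'b) monoid_scheme \<Rightarrow> (nat \<Rightarrow> 'a set set) \<Rightarrow> 'a set set" where
  "constant_core G h = (\<Inter>q\<in>{q. prime q}. Fitting_prod G (h q) (p'_group q))"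

context group
begin

lemma Fitting_set_constant_core:
  assumes fin: "finite (carrier G)" and h: "H_function G h"
  shows "Fitting_set G (constant_core G h)"
  unfolding constant_core_def
proof (rule Fitting_set_Inter)
  show "(\<lambda>q. Fitting_prod G (h q) (p'_group q)) ` {q. prime q} \<noteq> {}"
    using two_is_prime_nat by blast
qed (use Fitting_set_Fitting_prod_p'_group[OF fin] h in \<open>auto simp: H_function_def\<close>)

lemma mem_constant_core_iff:
  assumes fin: "finite (carrier G)" and h: "H_function G h"
  shows "K \<in> constant_core G h \<longleftrightarrow>
    subgroup K G \<and> (\<forall>q. prime q \<longrightarrow> K \<subseteq> pprime_mod G q K (radical G (h q) K))"
proof -
  have "K \<in> Fitting_prod G (h q) (p'_group q) \<longleftrightarrow>
      subgroup K G \<and> K \<subseteq> pprime_mod G q K (radical G (h q) K)" if "prime q" for q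
    using Fitting_prod_p'_group[OF fin] h that by (simp add: H_function_def)
  then show ?thesis using two_is_prime_nat by (auto simp only: constant_core_def)
qed

lemma mem_HS_iff:
  assumes fin: "finite (carrier G)" and h: "H_function G h"
  shows "K \<in> HS G h \<longleftrightarrow> subgroup K G \<and>
    (\<forall>p. prime p \<longrightarrow> (\<forall>x\<in>pprime_mod G p K (radical G (h p) K).
      \<forall>y\<in>pprime_mod G p K (radical G (h p) K). x \<otimes> y \<in> pprime_mod G p K (radical G (h p) K)))"
    (is "_ \<longleftrightarrow> _ \<and> (\<forall>p. prime p \<longrightarrow> ?closed p)")
proof -
  have "K \<in> Fitting_prod G (h p) (p_nilpotent p) \<longleftrightarrow> subgroup K G \<and> ?closed p" if "prime p" for p
    using Fitting_prod_p_nilpotent[OF fin] h that by (simp add: H_function_def)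
  moreover have "K \<in> HS G h \<longleftrightarrow> (\<forall>p. prime p \<longrightarrow> K \<in> Fitting_prod G (h p) (p_nilpotent p))"
    by (simp add: HS_def)
  ultimately show ?thesis using two_is_prime_nat by metis
qed

text \<open>Every \<open>p'\<close>-group is \<open>p\<close>-nilpotent.\<close>

lemma constant_core_subset_HS:
  assumes "finite (carrier G)" and "H_function G h"
  shows "constant_core G h \<subseteq> HS G h"
proof
  fix K assume K: "K \<in> constant_core G h"
  then have sK: "subgroup K G" using mem_constant_core_iff[OF assms] by simp
  have "pprime_mod G p K (radical G (h p) K) = K" if "prime p" for p
    using K that mem_constant_core_iff[OF assms] by (auto simp: pprime_mod_def)
  then show "K \<in> HS G h"
    using sK subgroup.m_closed[OF sK] by (simp add: mem_HS_iff[OF assms])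
qed

text \<open>Let \<open>V\<close> be the radical of \<open>K\<close> for the common intersection \<open>D\<close>, and \<open>N\<close> its radical for
  \<open>h p\<close>. Since \<open>V\<close> belongs to \<open>D\<close>, the factor \<open>V / (V \<inter> N)\<close> is a \<open>p'\<close>-group. Hence with \<open>K / V\<close> also
  \<open>K / (V \<inter> N)\<close> is \<open>p\<close>-nilpotent, and so is its quotient \<open>K / N\<close>.\<close>

lemma HS_constant_core_subset:
  assumes fin: "finite (carrier G)" and h: "H_function G h"
  shows "HS G (\<lambda>_. constant_core G h) \<subseteq> HS G h"
proof
  fix K assume KD: "K \<in> HS G (\<lambda>_. constant_core G h)"
  let ?D = "constant_core G h"
  let ?V = "radical G ?D K"
  have D: "Fitting_set G ?D" using fin h by (rule Fitting_set_constant_core)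
  then have HD: "H_function G (\<lambda>_. ?D)" by (simp add: H_function_def)
  have K: "subgroup K G" using KD mem_HS_iff[OF fin HD] by blast
  note V = radical_is_greatest[OF fin D K]
  have sV: "subgroup ?V G" using V(2) by (simp add: normal_in_iff[OF K])
  have "x \<otimes> y \<in> pprime_mod G p K (radical G (h p) K)"
    if p: "prime p" and xy: "x \<in> pprime_mod G p K (radical G (h p) K)"
      "y \<in> pprime_mod G p K (radical G (h p) K)" for p x y
  proof -
    let ?N = "radical G (h p) K"
    have F: "Fitting_set G (h p)" using h p by (simp add: H_function_def)
    note N = radical_is_greatest[OF fin F K]
    have sN: "subgroup ?N G" using N(2) by (simp add: normal_in_iff[OF K])
    let ?W = "?N \<inter> ?V"
    have W: "subgroup ?W G" using sN sV by (rule subgroups_Inter_pair)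
    have "?V \<subseteq> pprime_mod G p ?V (radical G (h p) ?V)"
      using V(1) p mem_constant_core_iff[OF fin h] by blast
    then have "?V \<subseteq> pprime_mod G p ?V ?W"
      by (simp only: radical_normal_subgroup[OF fin F K V(2)])
    then have "pprime_mod G p K ?V \<subseteq> pprime_mod G p K ?W"
      using subset_pprime_mod_trans[OF p W K] by blast
    then have "pprime_mod G p K ?W = pprime_mod G p K ?V" by (auto simp: pprime_mod_def)
    then show ?thesis
      using KD p mem_HS_iff[OF fin HD]
      by (intro pprime_mod_closed_mono[OF fin p K N(2) W _ _ xy]) auto
  qed
  then show "K \<in> HS G h" using K mem_HS_iff[OF fin h] by blast
qed

text \<open>For a prime \<open>q\<close> let \<open>A q\<close> be the normal subgroup of \<open>K\<close> whose image is the \<open>q\<close>-complement of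
  \<open>K / K\<^sub>h\<^sub>q\<close>. For each \<open>p\<close> the witness is \<open>W\<close>, the intersection of the radical for \<open>h p\<close> with all
  \<open>A q\<close> for \<open>q \<noteq> p\<close>. It belongs to the common intersection by construction, so the radical contains it,
  and \<open>K / W\<close> is \<open>p\<close>-nilpotent: it embeds in the product of the \<open>p\<close>-nilpotent \<open>K / K\<^sub>h\<^sub>p\<close> and the
  \<open>q\<close>-groups \<open>K / A q\<close>, which are \<open>p'\<close>-groups. On elements, this embedding says that the \<open>p\<close>-part of
  a product \<open>a \<otimes> b\<close> of \<open>p'\<close>-elements modulo \<open>W\<close> lies in \<open>W\<close> because it lies in every group that is intersected.\<close>

lemma HS_subset_HS_constant_core:
  assumes fin: "finite (carrier G)" and h: "H_function G h"
  shows "HS G h \<subseteq> HS G (\<lambda>_. constant_core G h)"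
proof
  fix K assume KH: "K \<in> HS G h"
  let ?D = "constant_core G h"
  let ?N = "\<lambda>q. radical G (h q) K"
  let ?A = "\<lambda>q. pprime_mod G q K (?N q)"
  have D: "Fitting_set G ?D" using fin h by (rule Fitting_set_constant_core)
  then have HD: "H_function G (\<lambda>_. ?D)" by (simp add: H_function_def)
  have K: "subgroup K G"
    and closed: "\<And>q x y. prime q \<Longrightarrow> x \<in> ?A q \<Longrightarrow> y \<in> ?A q \<Longrightarrow> x \<otimes> y \<in> ?A q"
    using KH mem_HS_iff[OF fin h] by blast+
  have F: "Fitting_set G (h q)" if "prime q" for q using h that by (simp add: H_function_def)
  have N: "normal_in G (?N q) K" if "prime q" for q
    using radical_is_greatest(2)[OF fin F[OF that] K] .
  have A: "normal_in G (?A q) K" if "prime q" for q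
    by (rule pprime_mod_normal_in[OF K N[OF that] that closed[OF that]])
  have sN: "subgroup (?N q) G" if "prime q" for q
    using N that by (auto simp: normal_in_iff[OF K])
  have "x \<otimes> y \<in> pprime_mod G p K (radical G ?D K)"
    if p: "prime p" and xy: "x \<in> pprime_mod G p K (radical G ?D K)"
      "y \<in> pprime_mod G p K (radical G ?D K)" for p x y
  proof -
    define W where "W = \<Inter>(insert (?N p) (?A ` {q. prime q \<and> q \<noteq> p}))"
    have W: "normal_in G W K"
      unfolding W_def using N[OF p] A by (intro normal_in_Inter[OF K]) auto
    have sW: "subgroup W G" using W by (simp add: normal_in_iff[OF K])
    have "W \<subseteq> pprime_mod G q W (radical G (h q) W)" if q: "prime q" for q
    proof
      fix w assume w: "w \<in> W"
      have "w \<in> ?A q"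
      proof (cases "q = p")
        case True
        then have "w [^] (1::nat) \<in> ?N q" "w \<in> K"
          using w W sW by (auto simp: W_def normal_in_iff[OF K] subgroup.mem_carrier)
        then show ?thesis using q by (auto simp: pprime_mod_def intro!: exI[of _ 1])
      qed (use w q in \<open>auto simp: W_def\<close>)
      then obtain m :: nat where m: "\<not> q dvd m" "w [^] m \<in> ?N q" by (auto simp: pprime_mod_def)
      moreover have "w [^] m \<in> W"
        using pow_dvd_mem[OF sW, of w 1 m] w subgroup.mem_carrier[OF sW w] by simp
      ultimately show "w \<in> pprime_mod G q W (radical G (h q) W)"
        using w radical_normal_subgroup[OF fin F[OF q] K W] by (auto simp: pprime_mod_def)
    qed
    then have "W \<in> ?D" using sW mem_constant_core_iff[OF fin h] by blast
    then have WD: "W \<subseteq> radical G ?D K" using radical_is_greatest(3)[OF fin D K] W by blast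
    obtain k r where r: "order G = p ^ k * r" "\<not> p dvd r"
      using order_prime_decomposition[OF fin p] .
    define P where "P = p ^ k"
    have "a \<otimes> b \<in> pprime_mod G p K W"
      if ab: "a \<in> pprime_mod G p K W" "b \<in> pprime_mod G p K W" for a b
    proof -
      have "pprime_mod G p K W \<subseteq> ?A p" by (auto simp: pprime_mod_def W_def)
      then have gA: "a \<otimes> b \<in> ?A p" using closed[OF p] ab by blast
      then have gK: "a \<otimes> b \<in> K" by (simp add: pprime_mod_def)
      have gc: "a \<otimes> b \<in> carrier G" using K gK by (rule subgroup.mem_carrier)
      \<comment> \<open>a generator of the \<open>p\<close>-part of the cyclic group of \<open>a \<otimes> b\<close>\<close>
      let ?g = "(a \<otimes> b) [^] r"
      have g: "?g \<in> K" "?g \<in> carrier G"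
        using pow_dvd_mem[OF K, of "a \<otimes> b" 1 r] gK gc by auto
      have gP: "?g [^] P = \<one>"
        using gc r(1) pow_order_eq_1[OF gc] by (simp add: nat_pow_pow P_def mult.commute)
      obtain m :: nat where m: "\<not> p dvd m" "(a \<otimes> b) [^] m \<in> ?N p"
        using gA by (auto simp: pprime_mod_def)
      have "coprime m P" using m(1) p unfolding P_def
        by (metis coprime_commute coprime_power_right_iff prime_imp_coprime)
      moreover have "?g [^] m \<in> ?N p"
        using pow_dvd_mem[OF sN[OF p] m(2) _ gc, of "r * m"] gc by (simp add: nat_pow_pow)
      ultimately have "?g \<in> ?N p"
        using coprime_pow_mem[OF sN[OF p] g(2), of m P] gP subgroup.one_closed[OF sN[OF p]] by simp
      moreover have "?g \<in> ?A q" if q: "prime q" "q \<noteq> p" for q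
      proof -
        have "\<not> q dvd P"
          unfolding P_def using p q by (metis prime_dvd_power primes_dvd_imp_eq)
        then show ?thesis
          using g gP subgroup.one_closed[OF sN[OF q(1)]] by (auto simp: pprime_mod_def)
      qed
      ultimately have "?g \<in> W" by (auto simp: W_def)
      then show ?thesis using gK r(2) by (auto simp: pprime_mod_def)
    qed
    then show ?thesis
      by (rule pprime_mod_closed_mono[OF fin p K radical_is_greatest(2)[OF fin D K] sW WD _ xy])
  qed
  then show "K \<in> HS G (\<lambda>_. ?D)" using K mem_HS_iff[OF fin HD] by blast
qed

text \<open>Each member \<open>S\<close> of a Fitting set \<open>F\<close> is its own radical, and \<open>S / S\<close> is a \<open>p'\<close>-group for all
  \<open>p\<close>. Fullness therefore comes for free once the H-function is constant.\<close>

lemma full_constant: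
  assumes fin: "finite (carrier G)" and F: "Fitting_set G F"
  shows "full G (\<lambda>_. F)"
proof -
  have "S \<in> Fitting_prod G F (p'_group q)" if S: "S \<in> F" and q: "prime q" for S q
  proof -
    have sS: "subgroup S G" using Fitting_setD(2)[OF F S] .
    have "normal_in G S S"
      using sS by (auto simp: normal_in_iff subgroup.m_closed subgroup.m_inv_closed)
    then have "S \<subseteq> radical G F S" using radical_is_greatest(3)[OF fin F sS S] by blast
    then show ?thesis
      using Fitting_prod_p'_group[OF fin F q] sS q
      by (auto simp: pprime_mod_def subgroup.mem_carrier intro!: exI[of _ 1])
  qed
  then show ?thesis by (auto simp: full_def)
qed

end

theorem lemma3p4:
  fixes G :: "('a, 'b) monoid_scheme" and \<H> :: "'a set set"
  assumes "group G" and "finite (carrier G)" and "Hartley_set G \<H>"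
  shows "\<exists>h. H_function G h \<and> full G h \<and> integrated G h \<and> \<H> = HS G h"
proof -
  interpret group G by fact
  obtain h where h: "H_function G h" "\<H> = HS G h" using assms(3) by (auto simp: Hartley_set_def)
  note D = Fitting_set_constant_core[OF assms(2) h(1)]
  have eq: "\<H> = HS G (\<lambda>_. constant_core G h)"
    using HS_constant_core_subset[OF assms(2) h(1)] HS_subset_HS_constant_core[OF assms(2) h(1)] h(2)
    by blast
  moreover have "integrated G (\<lambda>_. constant_core G h)"
    using constant_core_subset_HS[OF assms(2) h(1)] h(2) eq by (simp add: integrated_def)
  ultimately show ?thesis
    using D full_constant[OF assms(2) D] by (auto simp: H_function_def)
qed

end
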